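(* Let $n\in\mathbb N$, let $\Omega\subset\mathbb R^n$ be open, and let $a:(0,\infty)\to(0,\infty)$ be such that the function $b$ given by $b(t)=t\,a(t)$ for $t>0$, $b(0)=0$, satisfies $b\in C^1([0,\infty))$, and $$-\frac{1}{\sqrt{n+1}+1}<i_a\le s_a<\frac{1}{\sqrt{n+1}-1}.$$ Then there exist positive constants $c_1$ and $c_2$, depending only on $i_a$, $s_a$ and $n$, such that for every $u\in C^3(\Omega;\mathbb R^n)$ $$|\mathrm{div}(\mathcal A(\mathcal E u))|^2\ge c_1\,a^2(|\mathcal E u|)\,|\nabla\mathcal E u|^2+c_2\,\mathrm{div}\Big(a^2(|\mathcal E u|)\big((\Delta u)^T\mathcal E u-\tfrac12\nabla(|\mathcal E u|^2)+\tfrac12\,\mathrm{div}\,u\,((\Delta u)^T-\nabla\mathrm{div}\,u)\big)\Big)\quad\text{in }\Omega.$$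
   Context: $i_a=\inf_{t>0}\frac{t\,a'(t)}{a(t)}$ and $s_a=\sup_{t>0}\frac{t\,a'(t)}{a(t)}$. The function $a$ is extended continuously to $0$ by $a(0)=b'(0)$. The map $\mathcal A:\mathbb R^{n\times n}\to\mathbb R^{n\times n}$ is $\mathcal A(\xi)=a(|\xi|)\xi$ if $\xi\ne0$, $\mathcal A(0)=0$. $\mathcal E u=\tfrac12(\nabla u+(\nabla u)^T)$; $|\cdot|$ is the Euclidean norm of vectors, matrices (Frobenius) and third-order tensors; $a^2(t)=(a(t))^2$. $\Delta u$ is the column vector of componentwise Laplacians; gradients of scalar functions (such as $\nabla\mathrm{div}\,u$) are row vectors; the divergence of a row vector field is the usual one, and the divergence of a matrix field is taken row by row. *)

theory Defs
  imports "HOL-Analysis.Analysis"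
begin

text \<open>
  Column and row vectors are both rendered as \<open>real ^ 'n\<close>. The norm of \<open>real ^ 'n ^ 'n\<close> and of
  \<open>real ^ 'n ^ 'n ^ 'n\<close> is the Euclidean norm of the norms of the components, hence it is the
  Frobenius norm of matrices and the Euclidean norm of third-order tensors.
\<close>

section \<open>Differential operators\<close>

definition pderiv_at :: "'n::finite \<Rightarrow> (real ^ 'n \<Rightarrow> 'b::real_normed_vector) \<Rightarrow> real ^ 'n \<Rightarrow> 'b"
  where "pderiv_at k f x = frechet_derivative f (at x) (axis k 1)"

text \<open>
  Used for open \<open>S\<close> only. Each stage requires full differentiability, which together with the
  continuity of the highest partial derivatives is the usual notion of class \<open>C\<close>-\<open>k\<close>.
\<close>

primrec Ck_on :: "nat \<Rightarrow> (real ^ 'n::finite \<Rightarrow> 'b::real_normed_vector) \<Rightarrow> (real ^ 'n) set \<Rightarrow> bool"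
  where
    "Ck_on 0 f S \<longleftrightarrow> continuous_on S f"
  | "Ck_on (Suc k) f S \<longleftrightarrow>
       (\<forall>x\<in>S. f differentiable (at x)) \<and> (\<forall>j. Ck_on k (pderiv_at j f) S)"

text \<open>Applied to scalar, vector and matrix fields; the index of differentiation comes first.\<close>

definition grad :: "(real ^ 'n::finite \<Rightarrow> 'b::real_normed_vector) \<Rightarrow> real ^ 'n \<Rightarrow> 'b ^ 'n"
  where "grad f x = (\<chi> k. pderiv_at k f x)"

definition dvg :: "(real ^ 'n::finite \<Rightarrow> real ^ 'n) \<Rightarrow> real ^ 'n \<Rightarrow> real"
  where "dvg V x = (\<Sum>k\<in>UNIV. pderiv_at k (\<lambda>y. V y $ k) x)"

text \<open>Row by row: \<open>M y $ i\<close> is the \<open>i\<close>-th row of \<open>M y\<close>.\<close>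

definition mat_dvg :: "(real ^ 'n::finite \<Rightarrow> real ^ 'n ^ 'n) \<Rightarrow> real ^ 'n \<Rightarrow> real ^ 'n"
  where "mat_dvg M x = (\<chi> i. dvg (\<lambda>y. M y $ i) x)"

definition laplacian :: "(real ^ 'n::finite \<Rightarrow> real) \<Rightarrow> real ^ 'n \<Rightarrow> real"
  where "laplacian f x = (\<Sum>k\<in>UNIV. pderiv_at k (pderiv_at k f) x)"

definition vec_laplacian :: "(real ^ 'n::finite \<Rightarrow> real ^ 'n) \<Rightarrow> real ^ 'n \<Rightarrow> real ^ 'n"
  where "vec_laplacian u x = (\<chi> i. laplacian (\<lambda>y. u y $ i) x)"

definition sym_grad :: "(real ^ 'n::finite \<Rightarrow> real ^ 'n) \<Rightarrow> real ^ 'n \<Rightarrow> real ^ 'n ^ 'n"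
  where "sym_grad u x =
    (1 / 2) *\<^sub>R (jacobian u (at x) + transpose (jacobian u (at x)))"

section \<open>The function \<open>a\<close> and the associated quantities\<close>

text \<open>
  Throughout, only the values of \<open>a\<close> on \<open>{0<..}\<close> matter.
\<close>

definition b_of :: "(real \<Rightarrow> real) \<Rightarrow> real \<Rightarrow> real"
  where "b_of a t = (if t > 0 then t * a t else 0)"

definition C1_halfline :: "(real \<Rightarrow> real) \<Rightarrow> bool"
  where "C1_halfline f \<longleftrightarrow>
    f differentiable_on {0..} \<and>
    continuous_on {0..} (\<lambda>t. vector_derivative f (at t within {0..}))"

definition ext0 :: "(real \<Rightarrow> real) \<Rightarrow> real \<Rightarrow> real"
  where "ext0 a t = (if t > 0 then a t else vector_derivative (b_of a) (at 0 within {0..}))"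

text \<open>Extended reals, since the supremum may be infinite and the infimum may be minus infinity.\<close>

definition idx_inf :: "(real \<Rightarrow> real) \<Rightarrow> ereal"
  where "idx_inf a = (INF t\<in>{0<..}. ereal (t * deriv a t / a t))"

definition idx_sup :: "(real \<Rightarrow> real) \<Rightarrow> ereal"
  where "idx_sup a = (SUP t\<in>{0<..}. ereal (t * deriv a t / a t))"

definition A_map :: "(real \<Rightarrow> real) \<Rightarrow> real ^ 'n ^ 'n \<Rightarrow> real ^ 'n::finite ^ 'n"
  where "A_map a \<xi> = (if \<xi> \<noteq> 0 then a (norm \<xi>) *\<^sub>R \<xi> else 0)"

text \<open>
  The vector field under the divergence on the right-hand side. For \<open>u\<close> of class \<open>C\<close>-3 it is
  differentiable also where \<open>sym_grad u\<close> vanishes, although \<open>ext0 a\<close> need not be differentiable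
  at 0: there the bracket vanishes, and \<open>ext0 a\<close> is continuous at 0.
\<close>

definition flux :: "(real \<Rightarrow> real) \<Rightarrow> (real ^ 'n::finite \<Rightarrow> real ^ 'n) \<Rightarrow> real ^ 'n \<Rightarrow> real ^ 'n"
  where "flux a u x =
    (ext0 a (norm (sym_grad u x)))\<^sup>2 *\<^sub>R
      (vec_laplacian u x v* sym_grad u x
       - (1 / 2) *\<^sub>R grad (\<lambda>y. (norm (sym_grad u y))\<^sup>2) x
       + ((1 / 2) * dvg u x) *\<^sub>R (vec_laplacian u x - grad (dvg u) x))"

end

theory Submission
  imports Defs
begin

text \<open>
  Write \<open>E\<close> for the symmetric gradient, \<open>N = E / |E|\<close>, \<open>\<theta> = t a'(t) / a(t)\<close> at \<open>t = |E|\<close>, \<open>D = div E\<close>,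
  \<open>G = \<nabla> div u\<close>, \<open>h = \<nabla> |E|\<close> and \<open>\<tau> = tr N\<close>. The third derivatives of \<open>u\<close> cancel in
  the divergence on the right-hand side, and since \<open>\<Delta>u = 2 D - G\<close>, with \<open>P = N h\<close>
  \<open>div (\<A>(E)) = a (D + \<theta> P)\<close> and
  \<open>div (flux) = a\<^sup>2 (2 |D|\<^sup>2 - |G|\<^sup>2 - |\<nabla>E|\<^sup>2 + 2 \<theta> (2 D \<bullet> P - G \<bullet> P - |h|\<^sup>2 + \<tau> h \<bullet> (D - G)))\<close>.
  It remains to compare two quadratic forms in \<open>\<nabla>E\<close>. Passing to the derivatives
  \<open>V = \<nabla>E + \<theta> N \<otimes> h\<close> of \<open>\<A>(E)\<close> (up to the factor \<open>a\<close>), the second form is negative definite on the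
  kernel of \<open>D + \<theta> P\<close> because \<open>\<tau>\<^sup>2 \<le> n\<close> and \<open>(n + 1) \<theta>\<^sup>2 < (1 + \<theta>)\<^sup>2\<close>, which is what the bounds on
  the indices of \<open>a\<close> say. Where \<open>E\<close> vanishes the same formulas hold with \<open>\<theta> = 0\<close>.
\<close>

section \<open>The inequality between quadratic forms\<close>

text \<open>
  In the proof \<open>v\<close> is \<open>|V|\<^sup>2\<close> for \<open>w = |\<nabla>E|\<^sup>2\<close>, and the identity is obtained by completing the square
  in \<open>G\<close>; the only term of indefinite sign left over contains the factor \<open>D + \<theta> P\<close>.
\<close>

lemma pointwise_inequality:
  fixes D G h P :: "'a::real_inner" and \<theta> \<tau> w \<delta> m n :: real
  assumes h: "(norm h)\<^sup>2 \<le> w" and tau: "\<tau>\<^sup>2 \<le> n"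
    and delta: "0 \<le> \<delta>" "\<delta> \<le> 1 / 2" "2 * \<delta> * (1 + \<theta>)\<^sup>2 \<le> (1 + \<theta>)\<^sup>2 - (n + 1) * \<theta>\<^sup>2"
    and m: "m \<le> 1" "m \<le> (1 + \<theta>)\<^sup>2"
  shows "\<delta>\<^sup>2 * m * w + \<delta> * (2 * (norm D)\<^sup>2 - (norm G)\<^sup>2 - w
      + 2 * \<theta> * (2 * (D \<bullet> P) - G \<bullet> P - (norm h)\<^sup>2 + \<tau> * (h \<bullet> (D - G))))
    \<le> (1 + 2 * \<delta>) * (norm (D + \<theta> *\<^sub>R P))\<^sup>2" (is "_ + \<delta> * ?B \<le> _")
proof -
  define v where "v = w + (2 * \<theta> + \<theta>\<^sup>2) * (norm h)\<^sup>2"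
  define B where "B = ?B"
  define R where "R = norm (D + \<theta> *\<^sub>R P)"
  define c where "c = \<bar>\<theta> * \<tau>\<bar> * norm h"
  have v_ge: "(1 + \<theta>)\<^sup>2 * (norm h)\<^sup>2 \<le> v"
    using h by (simp add: v_def power2_eq_square algebra_simps)
  have nonneg: "0 \<le> \<theta>\<^sup>2" "0 \<le> \<delta> * (1 + \<theta>)\<^sup>2"
    using delta by auto
  have tn: "\<theta>\<^sup>2 * \<tau>\<^sup>2 \<le> \<theta>\<^sup>2 * n"
    using tau by (intro mult_left_mono) auto
  have exp_delta: "2 * (\<delta> * (1 + \<theta>)\<^sup>2) \<le> (1 + \<theta>)\<^sup>2 - \<theta>\<^sup>2 * n - \<theta>\<^sup>2"
    using delta(3) by (simp add: algebra_simps)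
  \<comment> \<open>Together with \<open>v_ge\<close> this bounds the coefficient \<open>c\<close>
    of the mixed term by the square root of \<open>v\<close>, as the use of Young's inequality below
    requires.\<close>
  have lead: "\<theta>\<^sup>2 * \<tau>\<^sup>2 \<le> (1 + \<theta>)\<^sup>2"
    by (rule order_trans[OF tn]) (use exp_delta nonneg in argo)
  have "c\<^sup>2 = \<theta>\<^sup>2 * \<tau>\<^sup>2 * (norm h)\<^sup>2"
    by (simp add: c_def power_mult_distrib)
  also have "\<dots> \<le> (1 + \<theta>)\<^sup>2 * (norm h)\<^sup>2"
    using lead by (rule mult_right_mono) simp
  also have "\<dots> \<le> v" by (rule v_ge)
  finally have c: "c\<^sup>2 \<le> v" .
  have identity: "2 * R\<^sup>2 - ?B = v + (norm (G + (\<theta> * \<tau>) *\<^sub>R h + \<theta> *\<^sub>R P))\<^sup>2 + \<theta>\<^sup>2 * (norm P)\<^sup>2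
      - \<theta>\<^sup>2 * (1 + \<tau>\<^sup>2) * (norm h)\<^sup>2 - 2 * (\<theta> * \<tau>) * (h \<bullet> (D + \<theta> *\<^sub>R P))"
    unfolding v_def R_def power2_norm_eq_inner
    by (simp add: inner_simps inner_commute power2_eq_square algebra_simps)
  have "(\<theta> * \<tau>) * (h \<bullet> (D + \<theta> *\<^sub>R P)) \<le> \<bar>\<theta> * \<tau>\<bar> * \<bar>h \<bullet> (D + \<theta> *\<^sub>R P)\<bar>"
    by (metis abs_ge_self abs_mult)
  also have "\<dots> \<le> \<bar>\<theta> * \<tau>\<bar> * (norm h * R)"
    unfolding R_def by (intro mult_left_mono Cauchy_Schwarz_ineq2) auto
  finally have cross: "(\<theta> * \<tau>) * (h \<bullet> (D + \<theta> *\<^sub>R P)) \<le> c * R"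
    by (simp add: c_def mult.assoc)
  \<comment> \<open>The condition on \<delta> says that (n + 1) \<theta>^2 is at most (1 - 2
    \<delta>) (1 + \<theta>)^2. As 1 + \<tau>^2 is at most n + 1, the negative term consumes only
    the fraction 1 - 2 \<delta> of \<open>v\<close>.\<close>
  have "\<theta>\<^sup>2 * (1 + \<tau>\<^sup>2) * (norm h)\<^sup>2 \<le> (1 - 2 * \<delta>) * (1 + \<theta>)\<^sup>2 * (norm h)\<^sup>2"
    by (intro mult_right_mono) (use tn exp_delta in \<open>simp_all add: algebra_simps\<close>)
  also have "\<dots> \<le> (1 - 2 * \<delta>) * v"
    using mult_left_mono[OF v_ge, of "1 - 2 * \<delta>"] delta(2) by (simp add: mult.assoc)
  finally have lower: "\<theta>\<^sup>2 * (1 + \<tau>\<^sup>2) * (norm h)\<^sup>2 \<le> v - 2 * \<delta> * v"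
    by (simp add: left_diff_distrib)
  have squares: "0 \<le> \<theta>\<^sup>2 * (norm P)\<^sup>2" "0 \<le> (norm (G + (\<theta> * \<tau>) *\<^sub>R h + \<theta> *\<^sub>R P))\<^sup>2"
    by simp_all
  have "2 * \<delta> * v - 2 * (c * R) \<le> 2 * R\<^sup>2 - ?B"
    unfolding identity using cross lower squares by argo
  then have "2 * \<delta> * v - 2 * (c * R) \<le> 2 * R\<^sup>2 - B"
    by (simp only: B_def)
  \<comment> \<open>After multiplication by \<delta>, Young's inequality for the product of
    \<open>\<delta> * c\<close> and \<open>R\<close> costs one of the two available copies of
    \<open>\<delta>\<^sup>2 * v\<close>, and one \<open>R\<^sup>2\<close>.\<close>
  then have "\<delta> * (2 * \<delta> * v - 2 * (c * R)) \<le> \<delta> * (2 * R\<^sup>2 - B)"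
    using delta(1) by (rule mult_left_mono)
  then have "2 * (\<delta>\<^sup>2 * v) - 2 * (\<delta> * c) * R \<le> 2 * (\<delta> * R\<^sup>2) - \<delta> * B"
    by (simp add: power2_eq_square algebra_simps)
  moreover have "2 * (\<delta> * c) * R \<le> (\<delta> * c)\<^sup>2 + R\<^sup>2"
    using sum_squares_bound[of "\<delta> * c" R] by simp
  moreover have "(\<delta> * c)\<^sup>2 \<le> \<delta>\<^sup>2 * v"
    unfolding power_mult_distrib using c by (intro mult_left_mono) auto
  moreover have "\<delta>\<^sup>2 * (m * w) \<le> \<delta>\<^sup>2 * v"
  proof (intro mult_left_mono)
    have "0 \<le> w" using h order_trans[OF zero_le_power2] by blast
    show "m * w \<le> v"
    \<comment> \<open>If the coefficient of |h|^2 in \<open>v\<close> is nonnegative,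
      \<open>v\<close> dominates \<open>w\<close>; otherwise |h|^2 \<le> w makes \<open>v\<close> at
      least (1 + \<theta>)^2 w. Hence the two upper bounds on \<open>m\<close>.\<close>
    proof (cases "0 \<le> 2 * \<theta> + \<theta>\<^sup>2")
      case True
      have "m * w \<le> w" using m(1) \<open>0 \<le> w\<close> mult_right_mono[of m 1 w] by simp
      also have "\<dots> \<le> v" using True by (simp add: v_def)
      finally show ?thesis .
    next
      case False
      have "m * w \<le> (1 + \<theta>)\<^sup>2 * w" using m(2) \<open>0 \<le> w\<close> by (rule mult_right_mono)
      also have "\<dots> = w + (2 * \<theta> + \<theta>\<^sup>2) * w" by (simp add: power2_eq_square algebra_simps)
      also have "\<dots> \<le> v" unfolding v_def using False h by (simp add: mult_left_mono_neg)
      finally show ?thesis .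
    qed
  qed simp
  ultimately have "\<delta>\<^sup>2 * (m * w) + \<delta> * B \<le> R\<^sup>2 + 2 * (\<delta> * R\<^sup>2)"
    by linarith
  then show ?thesis
    unfolding B_def R_def by (simp add: distrib_right mult.assoc)
qed

section \<open>Partial derivatives\<close>

text \<open>A partial derivative in the sense of \<open>pderiv_at\<close> is meaningful only where
  the function is fully differentiable. Carrying both facts in one predicate makes the calculus
  rules compositional.\<close>

definition has_pderiv ::
    "'n::finite \<Rightarrow> (real ^ 'n \<Rightarrow> 'b::real_normed_vector) \<Rightarrow> 'b \<Rightarrow> real ^ 'n \<Rightarrow> bool"
  where "has_pderiv k f d x \<longleftrightarrow> f differentiable (at x) \<and> pderiv_at k f x = d"

lemma has_pderiv_iff:
  "has_pderiv k f d x \<longleftrightarrow> (\<exists>f'. (f has_derivative f') (at x) \<and> f' (axis k 1) = d)"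
proof
  assume "has_pderiv k f d x"
  then show "\<exists>f'. (f has_derivative f') (at x) \<and> f' (axis k 1) = d"
    unfolding has_pderiv_def pderiv_at_def by (auto simp: frechet_derivative_works)
next
  assume "\<exists>f'. (f has_derivative f') (at x) \<and> f' (axis k 1) = d"
  then show "has_pderiv k f d x"
    unfolding has_pderiv_def pderiv_at_def
    by (auto simp: differentiable_def dest: frechet_derivative_at)
qed

lemma has_pderivI: "(f has_derivative f') (at x) \<Longrightarrow> f' (axis k 1) = d \<Longrightarrow> has_pderiv k f d x"
  unfolding has_pderiv_iff by blast

lemma has_pderivE:
  assumes "has_pderiv k f d x"
  obtains f' where "(f has_derivative f') (at x)" "f' (axis k 1) = d"
  using assms unfolding has_pderiv_iff by blast

lemma has_pderiv_imp_eq: "has_pderiv k f d x \<Longrightarrow> pderiv_at k f x = d"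
  by (simp add: has_pderiv_def)

lemma has_pderiv_pderiv_at: "f differentiable (at x) \<Longrightarrow> has_pderiv k f (pderiv_at k f x) x"
  by (simp add: has_pderiv_def)

lemma has_pderiv_add:
  "has_pderiv k f c x \<Longrightarrow> has_pderiv k g d x \<Longrightarrow> has_pderiv k (\<lambda>y. f y + g y) (c + d) x"
  by (elim has_pderivE, rule has_pderivI, rule has_derivative_add, assumption, assumption, simp)

lemma has_pderiv_diff:
  "has_pderiv k f c x \<Longrightarrow> has_pderiv k g d x \<Longrightarrow> has_pderiv k (\<lambda>y. f y - g y) (c - d) x"
  by (elim has_pderivE, rule has_pderivI, rule has_derivative_diff, assumption, assumption, simp)

lemma has_pderiv_bounded_linear:
  "bounded_linear L \<Longrightarrow> has_pderiv k f d x \<Longrightarrow> has_pderiv k (\<lambda>y. L (f y)) (L d) x"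
  by (elim has_pderivE, rule has_pderivI, rule bounded_linear.has_derivative, assumption, assumption, simp)

lemma has_pderiv_cmult:
  fixes f :: "real ^ 'n \<Rightarrow> real"
  shows "has_pderiv k f d x \<Longrightarrow> has_pderiv k (\<lambda>y. c * f y) (c * d) x"
  by (rule has_pderiv_bounded_linear[OF bounded_linear_mult_right])

lemma has_pderiv_vec_nth:
  fixes f :: "real ^ 'n::finite \<Rightarrow> ('b::real_normed_vector) ^ 'm::finite"
  shows "has_pderiv k f d x \<Longrightarrow> has_pderiv k (\<lambda>y. f y $ i) (d $ i) x"
  by (rule has_pderiv_bounded_linear[OF bounded_linear_vec_nth])

lemma has_pderiv_mult:
  fixes f :: "real ^ 'n::finite \<Rightarrow> real"
  assumes "has_pderiv k f c x" "has_pderiv k g d x"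
  shows "has_pderiv k (\<lambda>y. f y * g y) (c * g x + f x * d) x"
proof -
  from assms obtain f' g' where "(f has_derivative f') (at x)" "f' (axis k 1) = c"
    "(g has_derivative g') (at x)" "g' (axis k 1) = d"
    unfolding has_pderiv_iff by blast
  then show ?thesis
    by (intro has_pderivI[OF has_derivative_mult]) auto
qed

lemma has_pderiv_sum:
  "(\<And>i. i \<in> A \<Longrightarrow> has_pderiv k (f i) (d i) x) \<Longrightarrow>
    has_pderiv k (\<lambda>y. \<Sum>i\<in>A. f i y) (\<Sum>i\<in>A. d i) x"
proof (induction A rule: infinite_finite_induct)
  case (insert i A)
  then show ?case by (simp add: has_pderiv_add)
qed (auto intro: has_pderivI[OF has_derivative_const])

lemma has_pderiv_power2:
  fixes f :: "real ^ 'n::finite \<Rightarrow> real"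
  assumes "has_pderiv k f d x"
  shows "has_pderiv k (\<lambda>y. (f y)\<^sup>2) (2 * f x * d) x"
  using has_pderiv_mult[OF assms assms] by (simp add: power2_eq_square algebra_simps)

lemma has_pderiv_chain:
  fixes f :: "real ^ 'n::finite \<Rightarrow> real"
  assumes "(g has_real_derivative g') (at (f x))" "has_pderiv k f d x"
  shows "has_pderiv k (\<lambda>y. g (f y)) (g' * d) x"
proof -
  from assms(2) obtain f' where "(f has_derivative f') (at x)" "f' (axis k 1) = d"
    unfolding has_pderiv_iff by blast
  then show ?thesis
    using assms(1) by (intro has_pderivI[OF has_derivative_compose[of f f' x UNIV g "\<lambda>h. g' * h"]])
      (auto simp: has_field_derivative_def)
qed

lemma has_pderiv_norm:
  fixes f :: "real ^ 'n::finite \<Rightarrow> 'b::real_inner"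
  assumes "has_pderiv k f d x" "f x \<noteq> 0"
  shows "has_pderiv k (\<lambda>y. norm (f y)) ((f x \<bullet> d) / norm (f x)) x"
proof -
  from assms obtain f' where "(f has_derivative f') (at x)" "f' (axis k 1) = d"
    unfolding has_pderiv_iff by blast
  then show ?thesis
    using assms(2)
    by (intro has_pderivI[OF has_derivative_compose[of f f' x UNIV norm, OF _ has_derivative_norm]])
      (auto simp: sgn_div_norm inner_commute divide_inverse)
qed

lemma has_pderiv_transform_open:
  assumes "has_pderiv k f d x" "open S" "x \<in> S" "\<And>y. y \<in> S \<Longrightarrow> f y = g y"
  shows "has_pderiv k g d x"
proof -
  from assms(1) obtain f' where f': "(f has_derivative f') (at x)" "f' (axis k 1) = d"
    by (rule has_pderivE)
  then show ?thesis
    using has_derivative_transform_within_open[OF f'(1) assms(2-4)] by (intro has_pderivI)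
qed

lemma has_pderiv_vec_lambda:
  fixes f :: "'m::finite \<Rightarrow> real ^ 'n::finite \<Rightarrow> 'b::euclidean_space"
  assumes "\<And>i. has_pderiv k (f i) (d i) x"
  shows "has_pderiv k (\<lambda>y. \<chi> i. f i y) (\<chi> i. d i) x"
proof -
  from assms obtain f' where f': "\<And>i. (f i has_derivative f' i) (at x)" "\<And>i. f' i (axis k 1) = d i"
    unfolding has_pderiv_iff by metis
  have "((\<lambda>y. \<chi> i. f i y) has_derivative (\<lambda>h. \<chi> i. f' i h)) (at x)"
    unfolding has_derivative_componentwise_within[where f = "\<lambda>y. \<chi> i. f i y"]
    by (auto simp: Basis_vec_def inner_axis intro!: has_derivative_inner_left f')
  then show ?thesis
    by (rule has_pderivI) (simp add: f')
qed

text \<open>The factor \<open>\<phi>\<close> need not be differentiable because \<open>f\<close> vanishes at \<open>x\<close>.\<close>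

lemma has_pderiv_mult_vanishing:
  fixes f :: "real ^ 'n::finite \<Rightarrow> real"
  assumes f: "has_pderiv k f d x" "f x = 0" and phi: "isCont \<phi> x"
  shows "has_pderiv k (\<lambda>y. \<phi> y * f y) (\<phi> x * d) x"
proof -
  from f obtain f' where f': "(f has_derivative f') (at x)" "f' (axis k 1) = d"
    unfolding has_pderiv_iff by blast
  have *: "((\<lambda>y. norm (f y - f x - f' (y - x)) / norm (y - x)) \<longlongrightarrow> 0) (at x)"
    and bl: "bounded_linear f'"
    using f'(1) unfolding has_derivative_iff_norm by auto
  obtain K where K: "\<And>y. norm (f' y) \<le> norm y * K"
    using bounded_linear.bounded[OF bl] by blast
  have "((\<lambda>y. \<bar>\<phi> y\<bar> * (norm (f y - f x - f' (y - x)) / norm (y - x)) + \<bar>\<phi> y - \<phi> x\<bar> * K)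
      \<longlongrightarrow> \<bar>\<phi> x\<bar> * 0 + \<bar>\<phi> x - \<phi> x\<bar> * K) (at x)"
    using phi unfolding isCont_def by (intro tendsto_intros *)
  then have lim: "((\<lambda>y. \<bar>\<phi> y\<bar> * (norm (f y - f x - f' (y - x)) / norm (y - x)) + \<bar>\<phi> y - \<phi> x\<bar> * K)
      \<longlongrightarrow> 0) (at x)" by simp
  have "((\<lambda>y. norm (\<phi> y * f y - \<phi> x * f x - \<phi> x * f' (y - x)) / norm (y - x)) \<longlongrightarrow> 0) (at x)"
  proof (rule tendsto_sandwich[OF _ _ tendsto_const lim])
    show "\<forall>\<^sub>F y in at x. norm (\<phi> y * f y - \<phi> x * f x - \<phi> x * f' (y - x)) / norm (y - x)
        \<le> \<bar>\<phi> y\<bar> * (norm (f y - f x - f' (y - x)) / norm (y - x)) + \<bar>\<phi> y - \<phi> x\<bar> * K"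
      unfolding eventually_at_filter
    proof (intro always_eventually allI impI)
      fix y assume "y \<noteq> x"
      then have pos: "norm (y - x) > 0" by simp
      \<comment> \<open>The first summand is small because \<open>f\<close> is differentiable at
        \<open>x\<close>; the second because \<phi> is continuous there and f' grows at most
        linearly.\<close>
      have "\<phi> y * f y - \<phi> x * f x - \<phi> x * f' (y - x)
          = \<phi> y * (f y - f x - f' (y - x)) + (\<phi> y - \<phi> x) * f' (y - x)"
        using f(2) by (simp add: algebra_simps)
      then have "norm (\<phi> y * f y - \<phi> x * f x - \<phi> x * f' (y - x))
          \<le> \<bar>\<phi> y\<bar> * norm (f y - f x - f' (y - x)) + \<bar>\<phi> y - \<phi> x\<bar> * norm (f' (y - x))"
        by (metis abs_mult norm_triangle_ineq real_norm_def)
      also have "\<dots> \<le> \<bar>\<phi> y\<bar> * norm (f y - f x - f' (y - x)) + \<bar>\<phi> y - \<phi> x\<bar> * (norm (y - x) * K)"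
        using K by (intro add_left_mono mult_left_mono) auto
      finally show "norm (\<phi> y * f y - \<phi> x * f x - \<phi> x * f' (y - x)) / norm (y - x)
        \<le> \<bar>\<phi> y\<bar> * (norm (f y - f x - f' (y - x)) / norm (y - x)) + \<bar>\<phi> y - \<phi> x\<bar> * K"
        using pos by (simp add: field_simps)
    qed
  qed auto
  then have "((\<lambda>y. \<phi> y * f y) has_derivative (\<lambda>h. \<phi> x * f' h)) (at x)"
    unfolding has_derivative_iff_norm using bounded_linear_const_mult[OF bl] by auto
  then show ?thesis
    by (rule has_pderivI) (simp add: f')
qed

section \<open>Symmetry of second partial derivatives\<close>

lemma has_real_derivative_line:
  fixes f :: "real ^ 'n::finite \<Rightarrow> real"
  assumes "f differentiable (at (p + s *\<^sub>R axis i 1))"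
  shows "((\<lambda>r. f (p + r *\<^sub>R axis i 1)) has_real_derivative pderiv_at i f (p + s *\<^sub>R axis i 1)) (at s)"
proof -
  let ?q = "p + s *\<^sub>R axis i 1" and ?F = "frechet_derivative f (at (p + s *\<^sub>R axis i 1))"
  have F: "(f has_derivative ?F) (at ?q)"
    using assms by (simp add: frechet_derivative_works)
  have "((\<lambda>r. p + r *\<^sub>R axis i (1::real)) has_derivative (\<lambda>r. r *\<^sub>R axis i 1)) (at s)"
    by (auto intro!: derivative_eq_intros)
  from has_derivative_compose[OF this F]
  have "((\<lambda>r. f (p + r *\<^sub>R axis i 1)) has_derivative (\<lambda>r. ?F (r *\<^sub>R axis i 1))) (at s)" .
  moreover have "?F (r *\<^sub>R axis i 1) = pderiv_at i f ?q * r" for r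
    using linear_scale[OF has_derivative_linear[OF F]] by (simp add: pderiv_at_def)
  ultimately show ?thesis
    by (simp add: has_field_derivative_def)
qed

text \<open>The mean value theorem in direction \<open>i\<close> turns the second difference into an
  increment of \<open>pderiv_at i f\<close> over a step in direction \<open>j\<close>.
  Differentiability of \<open>pderiv_at i f\<close> at the point \<open>x\<close> then gives the
  limit.\<close>

lemma second_difference_tendsto:
  fixes f :: "real ^ 'n::finite \<Rightarrow> real"
  assumes S: "open S" "x \<in> S" and f: "\<And>y. y \<in> S \<Longrightarrow> f differentiable (at y)"
    and F: "pderiv_at i f differentiable (at x)"
  shows "((\<lambda>t. (f (x + t *\<^sub>R axis i 1 + t *\<^sub>R axis j 1) - f (x + t *\<^sub>R axis i 1)
      - f (x + t *\<^sub>R axis j 1) + f x) / t\<^sup>2) \<longlongrightarrow> pderiv_at j (pderiv_at i f) x) (at_right 0)"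
proof (rule tendstoI)
  fix \<epsilon> :: real assume "\<epsilon> > 0"
  let ?i = "axis i 1 :: real ^ 'n" and ?j = "axis j 1 :: real ^ 'n" and ?F = "pderiv_at i f"
  let ?F' = "frechet_derivative ?F (at x)"
  have F': "(?F has_derivative ?F') (at x)"
    using F by (simp add: frechet_derivative_works)
  have lin: "linear ?F'" by (rule has_derivative_linear[OF F'])
  \<comment> \<open>The two remainders below are at most two quarters and one quarter of \<epsilon>
    t, so their sum stays strictly below \<epsilon> t.\<close>
  obtain d where d: "d > 0"
    "\<And>y. norm (y - x) < d \<Longrightarrow> norm (?F y - ?F x - ?F' (y - x)) \<le> \<epsilon> / 4 * norm (y - x)"
    using F' \<open>\<epsilon> > 0\<close> unfolding has_derivative_at_alt by (meson divide_pos_pos zero_less_numeral)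
  obtain e where e: "e > 0" "ball x e \<subseteq> S"
    using S open_contains_ball by blast
  \<comment> \<open>Two steps of length at most \<open>t < r\<close> move the point by less than 2
    r, hence stay within both \<open>d\<close> and \<open>e\<close>.\<close>
  define r where "r = min d e / 2"
  have "r > 0" using d e by (simp add: r_def)
  show "\<forall>\<^sub>F t in at_right 0. dist ((f (x + t *\<^sub>R ?i + t *\<^sub>R ?j) - f (x + t *\<^sub>R ?i)
      - f (x + t *\<^sub>R ?j) + f x) / t\<^sup>2) (pderiv_at j ?F x) < \<epsilon>"
    unfolding eventually_at_right_field
  proof (intro exI[of _ r] conjI allI impI)
    show "0 < r" by fact
    fix t assume t: "0 < t" "t < r"
    define \<psi> where "\<psi> s = f ((x + t *\<^sub>R ?j) + s *\<^sub>R ?i) - f (x + s *\<^sub>R ?i)" for s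
    have small: "norm (c *\<^sub>R ?i + b *\<^sub>R ?j) < min d e" if "\<bar>c\<bar> \<le> t" "\<bar>b\<bar> \<le> t" for c b
      using norm_triangle_ineq[of "c *\<^sub>R ?i" "b *\<^sub>R ?j"] that t by (simp add: r_def)
    have inS: "x + c *\<^sub>R ?i \<in> S" "(x + t *\<^sub>R ?j) + c *\<^sub>R ?i \<in> S" if "\<bar>c\<bar> \<le> t" for c
    proof -
      have "norm ((c *\<^sub>R ?i + 0 *\<^sub>R ?j)) < e" "norm (c *\<^sub>R ?i + t *\<^sub>R ?j) < e"
        using small[OF that, of 0] small[OF that, of t] t by auto
      then show "x + c *\<^sub>R ?i \<in> S" "(x + t *\<^sub>R ?j) + c *\<^sub>R ?i \<in> S"
        using e(2) by (auto simp: dist_norm subset_iff norm_minus_commute algebra_simps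
            intro!: e(2)[THEN subsetD])
    qed
    have der: "(\<psi> has_real_derivative ?F ((x + t *\<^sub>R ?j) + s *\<^sub>R ?i) - ?F (x + s *\<^sub>R ?i)) (at s)"
      if "0 \<le> s" "s \<le> t" for s
      unfolding \<psi>_def using inS[of s] that
      by (intro DERIV_diff has_real_derivative_line f) auto
    obtain s where s: "0 < s" "s < t"
      and mv: "\<psi> t - \<psi> 0 = (t - 0) * (?F ((x + t *\<^sub>R ?j) + s *\<^sub>R ?i) - ?F (x + s *\<^sub>R ?i))"
      using MVT2[OF t(1) der] by blast
    let ?A = "?F (x + (s *\<^sub>R ?i + t *\<^sub>R ?j)) - ?F x - ?F' (s *\<^sub>R ?i + t *\<^sub>R ?j)"
    let ?B = "?F (x + s *\<^sub>R ?i) - ?F x - ?F' (s *\<^sub>R ?i)"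
    have A: "\<bar>?A\<bar> \<le> \<epsilon> / 4 * (2 * t)"
    proof -
      have "\<bar>?A\<bar> \<le> \<epsilon> / 4 * norm (s *\<^sub>R ?i + t *\<^sub>R ?j)"
        using d(2)[of "x + (s *\<^sub>R ?i + t *\<^sub>R ?j)"] small[of s t] s t by simp
      also have "\<dots> \<le> \<epsilon> / 4 * (2 * t)"
        using norm_triangle_ineq[of "s *\<^sub>R ?i" "t *\<^sub>R ?j"] s t \<open>\<epsilon> > 0\<close>
        by (intro mult_left_mono) auto
      finally show ?thesis .
    qed
    have B: "\<bar>?B\<bar> \<le> \<epsilon> / 4 * t"
    proof -
      have "\<bar>?B\<bar> \<le> \<epsilon> / 4 * norm (s *\<^sub>R ?i)"
        using d(2)[of "x + s *\<^sub>R ?i"] small[of s 0] s t by simp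
      also have "\<dots> \<le> \<epsilon> / 4 * t"
        using s t \<open>\<epsilon> > 0\<close> by (intro mult_left_mono) auto
      finally show ?thesis .
    qed
    \<comment> \<open>The linear parts in direction \<open>i\<close> cancel, so the unknown
      intermediate point \<open>s\<close> survives only in the remainders.\<close>
    have AB: "(?F ((x + t *\<^sub>R ?j) + s *\<^sub>R ?i) - ?F (x + s *\<^sub>R ?i)) - t * ?F' ?j = ?A - ?B"
      by (simp add: linear_add[OF lin] linear_scale[OF lin] algebra_simps)
    have num: "f (x + t *\<^sub>R ?i + t *\<^sub>R ?j) - f (x + t *\<^sub>R ?i) - f (x + t *\<^sub>R ?j) + f x = \<psi> t - \<psi> 0"
      by (simp add: \<psi>_def algebra_simps)
    have "(\<psi> t - \<psi> 0) / t\<^sup>2 - pderiv_at j ?F x = (?A - ?B) / t"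
      unfolding mv AB[symmetric] pderiv_at_def[of j] using t
      by (simp add: field_simps power2_eq_square)
    then have "\<bar>(\<psi> t - \<psi> 0) / t\<^sup>2 - pderiv_at j ?F x\<bar> = \<bar>?A - ?B\<bar> / t"
      using t by simp
    also have "\<dots> \<le> (\<epsilon> / 4 * (2 * t) + \<epsilon> / 4 * t) / t"
      using t by (intro divide_right_mono order_trans[OF abs_triangle_ineq4] add_mono A B) simp
    also have "\<dots> < \<epsilon>" using t \<open>\<epsilon> > 0\<close> by (simp add: field_simps)
    finally show "dist ((f (x + t *\<^sub>R ?i + t *\<^sub>R ?j) - f (x + t *\<^sub>R ?i)
      - f (x + t *\<^sub>R ?j) + f x) / t\<^sup>2) (pderiv_at j ?F x) < \<epsilon>"
      by (simp add: num dist_real_def)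
  qed
qed

text \<open>The second difference quotient is symmetric in \<open>i\<close> and \<open>j\<close>, so
  both iterated derivatives are its limit.\<close>

lemma pderiv_at_commute_real:
  fixes f :: "real ^ 'n::finite \<Rightarrow> real"
  assumes "open S" "x \<in> S" "\<And>y. y \<in> S \<Longrightarrow> f differentiable (at y)"
    and "\<And>k. pderiv_at k f differentiable (at x)"
  shows "pderiv_at j (pderiv_at i f) x = pderiv_at i (pderiv_at j f) x"
proof (rule tendsto_unique)
  show "((\<lambda>t. (f (x + t *\<^sub>R axis i 1 + t *\<^sub>R axis j 1) - f (x + t *\<^sub>R axis i 1)
      - f (x + t *\<^sub>R axis j 1) + f x) / t\<^sup>2) \<longlongrightarrow> pderiv_at j (pderiv_at i f) x) (at_right 0)"
    by (rule second_difference_tendsto[OF assms])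
  show "((\<lambda>t. (f (x + t *\<^sub>R axis i 1 + t *\<^sub>R axis j 1) - f (x + t *\<^sub>R axis i 1)
      - f (x + t *\<^sub>R axis j 1) + f x) / t\<^sup>2) \<longlongrightarrow> pderiv_at i (pderiv_at j f) x) (at_right 0)"
    using second_difference_tendsto[OF assms, of j i] by (simp add: algebra_simps)
qed simp

lemma pderiv_at_commute:
  fixes f :: "real ^ 'n::finite \<Rightarrow> real ^ 'm::finite"
  assumes S: "open S" "x \<in> S" and f: "\<And>y. y \<in> S \<Longrightarrow> f differentiable (at y)"
    and F: "\<And>k y. y \<in> S \<Longrightarrow> pderiv_at k f differentiable (at y)"
  shows "pderiv_at j (pderiv_at i f) x = pderiv_at i (pderiv_at j f) x"
proof (rule vec_eq_iff[THEN iffD2], rule allI)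
  fix l
  have 1: "has_pderiv k (\<lambda>z. f z $ l) (pderiv_at k f y $ l) y" if "y \<in> S" for k y
    using f[OF that] by (intro has_pderiv_vec_nth has_pderiv_pderiv_at)
  have 2: "has_pderiv m (pderiv_at k (\<lambda>z. f z $ l)) (pderiv_at m (pderiv_at k f) x $ l) x" for k m
  proof (rule has_pderiv_transform_open[OF _ S])
    show "has_pderiv m (\<lambda>z. pderiv_at k f z $ l) (pderiv_at m (pderiv_at k f) x $ l) x"
      using F[OF S(2)] by (intro has_pderiv_vec_nth has_pderiv_pderiv_at)
    show "pderiv_at k f y $ l = pderiv_at k (\<lambda>z. f z $ l) y" if "y \<in> S" for y
      using has_pderiv_imp_eq[OF 1[OF that]] by simp
  qed
  have "pderiv_at j (pderiv_at i (\<lambda>z. f z $ l)) x = pderiv_at i (pderiv_at j (\<lambda>z. f z $ l)) x"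
    using 1 2 by (intro pderiv_at_commute_real[OF S]) (auto simp: has_pderiv_def)
  then show "pderiv_at j (pderiv_at i f) x $ l = pderiv_at i (pderiv_at j f) x $ l"
    by (simp add: has_pderiv_imp_eq[OF 2])
qed

section \<open>Derivatives of the symmetric gradient\<close>

lemma norm_vec_squared: "(norm (v :: real ^ 'n::finite))\<^sup>2 = (\<Sum>i\<in>UNIV. (v $ i)\<^sup>2)"
  unfolding power2_norm_eq_inner by (simp add: inner_vec_def power2_eq_square)

lemma norm_matrix_squared:
  "(norm (A :: real ^ 'n::finite ^ 'm::finite))\<^sup>2 = (\<Sum>i\<in>UNIV. \<Sum>j\<in>UNIV. (A $ i $ j)\<^sup>2)"
  unfolding power2_norm_eq_inner by (simp add: inner_vec_def power2_eq_square)

lemma sym_grad_nth: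
  "sym_grad u y $ i $ j = (pderiv_at j u y $ i + pderiv_at i u y $ j) / 2"
  by (simp add: sym_grad_def jacobian_def matrix_def transpose_def pderiv_at_def)

locale C3_field =
  fixes S :: "(real ^ 'n::finite) set" and u :: "real ^ 'n \<Rightarrow> real ^ 'n"
  assumes open_S: "open S" and C3: "Ck_on 3 u S"
begin

text \<open>Derivatives are taken of the whole vector field and projected to a component afterwards,
  because this is the form in which \<open>Ck_on\<close> supplies differentiability.\<close>

definition D1 :: "'n \<Rightarrow> 'n \<Rightarrow> real ^ 'n \<Rightarrow> real"
  where "D1 j i y = pderiv_at j u y $ i"

definition D2 :: "'n \<Rightarrow> 'n \<Rightarrow> 'n \<Rightarrow> real ^ 'n \<Rightarrow> real"
  where "D2 k j i y = pderiv_at k (pderiv_at j u) y $ i"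

definition D3 :: "'n \<Rightarrow> 'n \<Rightarrow> 'n \<Rightarrow> 'n \<Rightarrow> real ^ 'n \<Rightarrow> real"
  where "D3 l k j i y = pderiv_at l (pderiv_at k (pderiv_at j u)) y $ i"

lemma differentiable_D:
  assumes "y \<in> S"
  shows "u differentiable (at y)" "pderiv_at j u differentiable (at y)"
    "pderiv_at k (pderiv_at j u) differentiable (at y)"
  using C3 assms by (simp_all add: numeral_3_eq_3)

lemma D1: "y \<in> S \<Longrightarrow> has_pderiv k (\<lambda>z. u z $ i) (D1 k i y) y"
  unfolding D1_def by (rule has_pderiv_vec_nth[OF has_pderiv_pderiv_at]) (rule differentiable_D)

lemma D2: "y \<in> S \<Longrightarrow> has_pderiv k (D1 j i) (D2 k j i y) y"
  unfolding D1_def D2_def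
  by (rule has_pderiv_vec_nth[OF has_pderiv_pderiv_at]) (rule differentiable_D)

lemma D3: "y \<in> S \<Longrightarrow> has_pderiv l (D2 k j i) (D3 l k j i y) y"
  unfolding D2_def D3_def
  by (rule has_pderiv_vec_nth[OF has_pderiv_pderiv_at]) (rule differentiable_D)

lemma D2_commute: "y \<in> S \<Longrightarrow> D2 k j i y = D2 j k i y"
  unfolding D2_def using pderiv_at_commute[OF open_S, of y u k j] differentiable_D by simp

lemma D3_commute_outer: "y \<in> S \<Longrightarrow> D3 l k j i y = D3 k l j i y"
  unfolding D3_def using pderiv_at_commute[OF open_S, of y "pderiv_at j u" l k] differentiable_D by simp

text \<open>\<open>D2_commute\<close> holds throughout the open set \<open>S\<close>, so it may be
  differentiated in direction \<open>l\<close>.\<close>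

lemma D3_commute_inner:
  assumes "y \<in> S"
  shows "D3 l k j i y = D3 l j k i y"
proof -
  have "has_pderiv l (D2 j k i) (D3 l k j i y) y"
    by (rule has_pderiv_transform_open[OF D3 open_S]) (simp_all add: assms D2_commute)
  with D3[OF assms] show ?thesis
    by (metis has_pderiv_imp_eq)
qed

text \<open>From here on the calculus is done with scalar components that are explicit sums of
  \<open>D1\<close>, \<open>D2\<close> and \<open>D3\<close>. The lemmas below identify them on
  \<open>S\<close> with the operators of the theorem.\<close>

definition strain :: "'n \<Rightarrow> 'n \<Rightarrow> real ^ 'n \<Rightarrow> real"
  where "strain i j y = (D1 j i y + D1 i j y) / 2"

definition dstrain :: "'n \<Rightarrow> 'n \<Rightarrow> 'n \<Rightarrow> real ^ 'n \<Rightarrow> real"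
  where "dstrain k i j y = (D2 k j i y + D2 k i j y) / 2"

definition ddstrain :: "'n \<Rightarrow> 'n \<Rightarrow> 'n \<Rightarrow> 'n \<Rightarrow> real ^ 'n \<Rightarrow> real"
  where "ddstrain l k i j y = (D3 l k j i y + D3 l k i j y) / 2"

definition lap :: "'n \<Rightarrow> real ^ 'n \<Rightarrow> real"
  where "lap i y = (\<Sum>k\<in>UNIV. D2 k k i y)"

definition div_u :: "real ^ 'n \<Rightarrow> real"
  where "div_u y = (\<Sum>k\<in>UNIV. D1 k k y)"

definition ddiv_u :: "'n \<Rightarrow> real ^ 'n \<Rightarrow> real"
  where "ddiv_u j y = (\<Sum>k\<in>UNIV. D2 j k k y)"

definition div_strain :: "'n \<Rightarrow> real ^ 'n \<Rightarrow> real"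
  where "div_strain i y = (\<Sum>j\<in>UNIV. dstrain j i j y)"

lemma sym_grad_eq_strain: "sym_grad u y $ i $ j = strain i j y"
  by (simp add: sym_grad_nth strain_def D1_def)

lemma has_pderiv_strain: "y \<in> S \<Longrightarrow> has_pderiv k (strain i j) (dstrain k i j y) y"
  using has_pderiv_cmult[OF has_pderiv_add[OF D2 D2], of y k "1 / 2" j i i j]
  by (simp add: strain_def[abs_def] dstrain_def)

lemma has_pderiv_dstrain: "y \<in> S \<Longrightarrow> has_pderiv l (dstrain k i j) (ddstrain l k i j y) y"
  using has_pderiv_cmult[OF has_pderiv_add[OF D3 D3], of y l "1 / 2" k j i k i j]
  by (simp add: dstrain_def[abs_def] ddstrain_def)

lemma has_pderiv_lap: "y \<in> S \<Longrightarrow> has_pderiv j (lap i) (\<Sum>k\<in>UNIV. D3 j k k i y) y"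
  unfolding lap_def[abs_def] by (intro has_pderiv_sum D3)

lemma has_pderiv_div_u: "y \<in> S \<Longrightarrow> has_pderiv j div_u (ddiv_u j y) y"
  unfolding div_u_def[abs_def] ddiv_u_def by (intro has_pderiv_sum D2)

lemma has_pderiv_ddiv_u: "y \<in> S \<Longrightarrow> has_pderiv l (ddiv_u j) (\<Sum>k\<in>UNIV. D3 l j k k y) y"
  unfolding ddiv_u_def[abs_def] by (intro has_pderiv_sum D3)

lemma has_pderiv_sym_grad:
  assumes "y \<in> S"
  shows "has_pderiv k (sym_grad u) (\<chi> i j. dstrain k i j y) y"
proof -
  have "sym_grad u = (\<lambda>z. \<chi> i j. strain i j z)"
    by (simp add: fun_eq_iff vec_eq_iff sym_grad_eq_strain)
  then show ?thesis
    using assms by (simp add: has_pderiv_vec_lambda has_pderiv_strain)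
qed

lemma grad_sym_grad: "y \<in> S \<Longrightarrow> grad (sym_grad u) y = (\<chi> k i j. dstrain k i j y)"
  by (simp add: grad_def has_pderiv_imp_eq[OF has_pderiv_sym_grad])

lemma dvg_u:
  assumes "y \<in> S"
  shows "dvg u y = div_u y"
  by (simp add: dvg_def div_u_def has_pderiv_imp_eq[OF D1[OF assms]])

lemma grad_dvg_u:
  assumes "y \<in> S"
  shows "grad (dvg u) y $ j = ddiv_u j y"
proof -
  have "has_pderiv j (dvg u) (ddiv_u j y) y"
    by (rule has_pderiv_transform_open[OF has_pderiv_div_u open_S]) (simp_all add: assms dvg_u)
  then show ?thesis
    by (simp add: grad_def has_pderiv_imp_eq)
qed

lemma vec_laplacian_u:
  assumes "y \<in> S"
  shows "vec_laplacian u y $ i = lap i y"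
proof -
  have "pderiv_at k (pderiv_at k (\<lambda>z. u z $ i)) y = D2 k k i y" for k
    by (rule has_pderiv_imp_eq, rule has_pderiv_transform_open[OF D2 open_S])
      (simp_all add: assms has_pderiv_imp_eq[OF D1])
  then show ?thesis
    by (simp add: vec_laplacian_def laplacian_def lap_def)
qed

lemma grad_norm_sym_grad:
  assumes "y \<in> S"
  shows "grad (\<lambda>z. (norm (sym_grad u z))\<^sup>2) y $ j
    = (\<Sum>a\<in>UNIV. \<Sum>b\<in>UNIV. 2 * strain a b y * dstrain j a b y)"
  unfolding norm_matrix_squared sym_grad_eq_strain grad_def
  using assms by (simp add: has_pderiv_imp_eq[OF has_pderiv_sum[OF has_pderiv_sum[OF
      has_pderiv_power2[OF has_pderiv_strain]]]])

text \<open>Component \<open>j\<close> of the vector that \<open>flux\<close> multiplies by the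
  squared coefficient. The factor 1/2 before the gradient of |E|^2 has been cancelled against the 2
  from differentiating the square.\<close>

definition bracket :: "'n \<Rightarrow> real ^ 'n \<Rightarrow> real"
  where "bracket j y = (\<Sum>i\<in>UNIV. lap i y * strain i j y)
    - (\<Sum>a\<in>UNIV. \<Sum>b\<in>UNIV. strain a b y * dstrain j a b y)
    + (1 / 2) * (div_u y * (lap j y - ddiv_u j y))"

lemma flux_eq_bracket:
  assumes "y \<in> S"
  shows "flux a u y $ j = (ext0 a (norm (sym_grad u y)))\<^sup>2 * bracket j y"
proof -
  have "(1 / 2) * (\<Sum>a\<in>UNIV. \<Sum>b\<in>UNIV. 2 * strain a b y * dstrain j a b y)
      = (\<Sum>a\<in>UNIV. \<Sum>b\<in>UNIV. strain a b y * dstrain j a b y)"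
    by (simp add: sum_distrib_left mult.assoc)
  then show ?thesis
    using assms by (simp add: flux_def bracket_def vector_matrix_mult_def vec_laplacian_u grad_dvg_u
      grad_norm_sym_grad dvg_u sym_grad_eq_strain mult_ac)
qed

text \<open>Kept in the shape that the product rules produce, so that
  \<open>has_pderiv_bracket\<close> follows by applying them; all simplification is left to
  \<open>sum_dbracket\<close>.\<close>

definition dbracket :: "'n \<Rightarrow> real ^ 'n \<Rightarrow> real"
  where "dbracket j y =
    (\<Sum>i\<in>UNIV. (\<Sum>k\<in>UNIV. D3 j k k i y) * strain i j y + lap i y * dstrain j i j y)
    - (\<Sum>a\<in>UNIV. \<Sum>b\<in>UNIV. dstrain j a b y * dstrain j a b y + strain a b y * ddstrain j j a b y)
    + (1 / 2) * (ddiv_u j y * (lap j y - ddiv_u j y)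
      + div_u y * ((\<Sum>k\<in>UNIV. D3 j k k j y) - (\<Sum>k\<in>UNIV. D3 j j k k y)))"

lemma has_pderiv_bracket: "y \<in> S \<Longrightarrow> has_pderiv j (bracket j) (dbracket j y) y"
  unfolding bracket_def[abs_def] dbracket_def
  by (intro has_pderiv_add has_pderiv_diff has_pderiv_sum has_pderiv_cmult has_pderiv_mult
      has_pderiv_lap has_pderiv_strain has_pderiv_dstrain has_pderiv_div_u has_pderiv_ddiv_u)

text \<open>Twice the derivative of E_ij in direction \<open>j\<close> consists of a summand of the
  Laplacian of u_i and a mixed derivative; commuting the latter gives a summand of the derivative of
  div u in direction \<open>i\<close>.\<close>

lemma lap_eq:
  assumes "y \<in> S"
  shows "lap i y = 2 * div_strain i y - ddiv_u i y"
proof -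
  have "2 * div_strain i y = (\<Sum>j\<in>UNIV. D2 j j i y + D2 i j j y)"
    unfolding div_strain_def dstrain_def sum_distrib_left
    by (intro sum.cong refl) (simp add: D2_commute[OF assms, of _ i])
  then show ?thesis
    by (simp add: lap_def ddiv_u_def sum.distrib)
qed

text \<open>Every third-order term is either part of the contraction \<open>?T\<close> of E with the
  Laplacian of the gradient of u, or of the Laplacian of div u; each of these occurs with both
  signs.\<close>

lemma sum_dbracket:
  assumes "y \<in> S"
  shows "(\<Sum>j\<in>UNIV. dbracket j y) = 2 * (\<Sum>i\<in>UNIV. (div_strain i y)\<^sup>2) - (\<Sum>i\<in>UNIV. (ddiv_u i y)\<^sup>2)
    - (\<Sum>k\<in>UNIV. \<Sum>a\<in>UNIV. \<Sum>b\<in>UNIV. (dstrain k a b y)\<^sup>2)"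
proof -
  let ?T = "\<Sum>j\<in>UNIV. \<Sum>i\<in>UNIV. \<Sum>k\<in>UNIV. D3 k k j i y * strain i j y"
  have swap: "D3 j k k i y = D3 k k j i y" for i j k
    using D3_commute_outer[OF assms, of j k k i] D3_commute_inner[OF assms, of k j k i] by simp
  have strain_sym: "strain i j y = strain j i y" for i j
    by (simp add: strain_def)
  have third1: "(\<Sum>j\<in>UNIV. \<Sum>i\<in>UNIV. (\<Sum>k\<in>UNIV. D3 j k k i y) * strain i j y) = ?T"
    unfolding sum_distrib_right by (intro sum.cong refl arg_cong2[where f = "(*)"] swap)
  have T': "(\<Sum>j\<in>UNIV. \<Sum>a\<in>UNIV. \<Sum>b\<in>UNIV. strain a b y * D3 j j b a y) = ?T"
  proof -
    have "?T = (\<Sum>i\<in>UNIV. \<Sum>j\<in>UNIV. \<Sum>k\<in>UNIV. D3 k k j i y * strain i j y)"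
      by (rule sum.swap)
    also have "\<dots> = (\<Sum>i\<in>UNIV. \<Sum>k\<in>UNIV. \<Sum>j\<in>UNIV. D3 k k j i y * strain i j y)"
      by (rule sum.cong[OF refl], rule sum.swap)
    also have "\<dots> = (\<Sum>k\<in>UNIV. \<Sum>i\<in>UNIV. \<Sum>j\<in>UNIV. D3 k k j i y * strain i j y)"
      by (rule sum.swap)
    finally show ?thesis by (simp add: mult.commute)
  qed
  \<comment> \<open>Since E is symmetric, contracting it with a matrix or with its transpose gives
    the same value.\<close>
  have T'': "(\<Sum>j\<in>UNIV. \<Sum>a\<in>UNIV. \<Sum>b\<in>UNIV. strain a b y * D3 j j a b y) = ?T"
    unfolding T'[symmetric]
    by (rule sum.cong[OF refl], rule trans[OF sum.swap]) (simp add: strain_sym)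
  have third2: "(\<Sum>j\<in>UNIV. \<Sum>a\<in>UNIV. \<Sum>b\<in>UNIV. strain a b y * ddstrain j j a b y) = ?T"
  proof -
    have "(\<Sum>j\<in>UNIV. \<Sum>a\<in>UNIV. \<Sum>b\<in>UNIV. strain a b y * ddstrain j j a b y)
      = (\<Sum>j\<in>UNIV. \<Sum>a\<in>UNIV. \<Sum>b\<in>UNIV. strain a b y * D3 j j b a y + strain a b y * D3 j j a b y) / 2"
      by (simp add: ddstrain_def sum_divide_distrib distrib_left)
    also have "\<dots> = ?T" by (simp only: sum.distrib T' T'')  simp
    finally show ?thesis .
  qed
  \<comment> \<open>Both sides are the Laplacian of div u.\<close>
  have third3: "(\<Sum>j\<in>UNIV. \<Sum>k\<in>UNIV. D3 j k k j y) = (\<Sum>j\<in>UNIV. \<Sum>k\<in>UNIV. D3 j j k k y)"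
    by (subst sum.swap, intro sum.cong refl swap)
  have first: "(\<Sum>j\<in>UNIV. \<Sum>i\<in>UNIV. lap i y * dstrain j i j y) = (\<Sum>i\<in>UNIV. lap i y * div_strain i y)"
    by (subst sum.swap) (simp add: div_strain_def sum_distrib_left)
  have "(\<Sum>j\<in>UNIV. dbracket j y)
     = (\<Sum>j\<in>UNIV. \<Sum>i\<in>UNIV. (\<Sum>k\<in>UNIV. D3 j k k i y) * strain i j y)
     + (\<Sum>j\<in>UNIV. \<Sum>i\<in>UNIV. lap i y * dstrain j i j y)
     - ((\<Sum>j\<in>UNIV. \<Sum>a\<in>UNIV. \<Sum>b\<in>UNIV. dstrain j a b y * dstrain j a b y)
       + (\<Sum>j\<in>UNIV. \<Sum>a\<in>UNIV. \<Sum>b\<in>UNIV. strain a b y * ddstrain j j a b y))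
     + (1 / 2) * ((\<Sum>j\<in>UNIV. ddiv_u j y * (lap j y - ddiv_u j y))
       + div_u y * ((\<Sum>j\<in>UNIV. \<Sum>k\<in>UNIV. D3 j k k j y) - (\<Sum>j\<in>UNIV. \<Sum>k\<in>UNIV. D3 j j k k y)))"
    unfolding dbracket_def
    by (simp only: sum.distrib sum_subtractf sum_distrib_left[symmetric])
  then have "(\<Sum>j\<in>UNIV. dbracket j y) = (\<Sum>i\<in>UNIV. lap i y * div_strain i y)
     - (\<Sum>j\<in>UNIV. \<Sum>a\<in>UNIV. \<Sum>b\<in>UNIV. dstrain j a b y * dstrain j a b y)
     + (1 / 2) * (\<Sum>j\<in>UNIV. ddiv_u j y * (lap j y - ddiv_u j y))"
    unfolding third1 third2 third3 first by simp
  \<comment> \<open>With \<Delta>u = 2 D - G, the products of D and G cancel between the two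
    sums.\<close>
  moreover have "(\<Sum>i\<in>UNIV. lap i y * div_strain i y) + (1 / 2) * (\<Sum>j\<in>UNIV. ddiv_u j y * (lap j y - ddiv_u j y))
     = 2 * (\<Sum>i\<in>UNIV. (div_strain i y)\<^sup>2) - (\<Sum>i\<in>UNIV. (ddiv_u i y)\<^sup>2)"
    unfolding lap_eq[OF assms] sum_distrib_left sum.distrib[symmetric] sum_subtractf[symmetric]
    by (intro sum.cong refl) (simp add: power2_eq_square algebra_simps)
  ultimately show ?thesis
    by (simp add: power2_eq_square)
qed

end

section \<open>The two divergences\<close>

text \<open>Near a positive point, \<open>a\<close> is the quotient of \<open>b_of a\<close> by the
  identity.\<close>

lemma DERIV_of_C1_halfline:
  assumes "C1_halfline (b_of a)" "t > 0"
  shows "(a has_real_derivative deriv a t) (at t)"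
proof -
  have "b_of a differentiable (at t within {0..})"
    using assms by (auto simp: C1_halfline_def differentiable_on_def)
  then have "b_of a differentiable (at t)"
    using assms(2) at_within_interior[of t "{0::real..}"] by simp
  then have "(\<lambda>s. b_of a s / s) differentiable (at t)"
    using assms(2) by (intro differentiable_divide) auto
  then have "a differentiable (at t)"
  proof (rule differentiable_transform_within[OF _ assms(2)])
    fix s assume "dist s t < t"
    then show "b_of a s / s = a s"
      by (auto simp: b_of_def dist_real_def)
  qed simp
  then show ?thesis
    by (simp add: DERIV_deriv_iff_real_differentiable)
qed

lemma DERIV_ext0:
  assumes "C1_halfline (b_of a)" "t > 0"
  shows "(ext0 a has_real_derivative deriv a t) (at t)"
  by (rule has_field_derivative_transform_within_open[OF DERIV_of_C1_halfline[OF assms], of "{0<..}"])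
    (use assms in \<open>auto simp: ext0_def\<close>)

text \<open>For positive arguments the difference quotient of \<open>b_of a\<close> at 0 is
  \<open>a\<close> itself, so its limit is the value that \<open>ext0\<close> assigns at 0.\<close>

lemma continuous_ext0_at_0:
  assumes "C1_halfline (b_of a)"
  shows "continuous (at 0 within {0..}) (ext0 a)"
proof -
  have "b_of a differentiable (at 0 within {0..})"
    using assms by (auto simp: C1_halfline_def differentiable_on_def)
  then have "(b_of a has_vector_derivative ext0 a 0) (at 0 within {0..})"
    unfolding ext0_def by (simp add: vector_derivative_works)
  then have "((\<lambda>s. (b_of a s - b_of a 0) / (s - 0)) \<longlongrightarrow> ext0 a 0) (at 0 within {0..})"
    by (simp only: has_real_derivative_iff_has_vector_derivative[symmetric] has_field_derivative_iff)
  then have "(ext0 a \<longlongrightarrow> ext0 a 0) (at 0 within {0..})"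
  proof (rule Lim_transform_eventually)
    show "\<forall>\<^sub>F s in at 0 within {0..}. (b_of a s - b_of a 0) / (s - 0) = ext0 a s"
      by (auto simp: eventually_at_filter b_of_def ext0_def)
  qed
  then show ?thesis
    by (simp add: continuous_within)
qed

text \<open>At the zero matrix \<open>ext0 a 0\<close> multiplies a zero entry, which makes the case
  distinction in \<open>A_map\<close> disappear.\<close>

lemma A_map_nth: "A_map a \<xi> $ i $ j = ext0 a (norm \<xi>) * \<xi> $ i $ j"
  by (simp add: A_map_def ext0_def)

text \<open>Cauchy-Schwarz against the all-ones vector, then adding the off-diagonal squares.
  Applied to E, it yields the bound on \<tau> in \<open>pointwise_inequality\<close>.\<close>

lemma trace_squared_le:
  "(\<Sum>i\<in>UNIV. A $ i $ i)\<^sup>2 \<le> real CARD('n) * (norm (A :: real ^ 'n::finite ^ 'n))\<^sup>2"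
proof -
  have "(\<Sum>i\<in>UNIV. A $ i $ i)\<^sup>2 \<le> real CARD('n) * (\<Sum>i\<in>UNIV. (A $ i $ i)\<^sup>2)"
    using Cauchy_Schwarz_ineq_sum[of "\<lambda>_. 1" "\<lambda>i. A $ i $ i" UNIV] by simp
  also have "\<dots> \<le> real CARD('n) * (norm A)\<^sup>2"
    unfolding norm_matrix_squared
    by (intro mult_left_mono sum_mono member_le_sum[where f = "\<lambda>j. (A $ _ $ j)\<^sup>2"]) auto
  finally show ?thesis .
qed

section \<open>Evaluation of both divergences where E vanishes and where it does not\<close>

context C3_field
begin

text \<open>\<open>dE\<close>, \<open>vD\<close> and \<open>vG\<close> repackage the components so
  that the norms and inner products of \<open>pointwise_inequality\<close> apply to them.\<close>

definition dE :: "real ^ 'n \<Rightarrow> real ^ 'n ^ 'n ^ 'n"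
  where "dE x = (\<chi> k i j. dstrain k i j x)"

definition vD :: "real ^ 'n \<Rightarrow> real ^ 'n"
  where "vD x = (\<chi> i. div_strain i x)"

definition vG :: "real ^ 'n \<Rightarrow> real ^ 'n"
  where "vG x = (\<chi> i. ddiv_u i x)"

lemma sum_dbracket_norm:
  assumes "x \<in> S"
  shows "(\<Sum>k\<in>UNIV. dbracket k x) = 2 * (norm (vD x))\<^sup>2 - (norm (vG x))\<^sup>2 - (norm (dE x))\<^sup>2"
proof -
  have "(norm (dE x))\<^sup>2 = (\<Sum>k\<in>UNIV. (norm (dE x $ k))\<^sup>2)"
    unfolding power2_norm_eq_inner by (simp add: inner_vec_def[of "dE x" "dE x"])
  then show ?thesis
    by (simp add: sum_dbracket[OF assms] norm_matrix_squared norm_vec_squared dE_def vD_def vG_def)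
qed

text \<open>Eliminates the Laplacian by \<open>lap_eq\<close>, leaving only D, G and the derivatives
  of E. In \<open>2 * vD x\<close> the product is componentwise, with the constant vector 2.\<close>

lemma bracket_eq:
  assumes "x \<in> S"
  shows "bracket k x = (\<Sum>i\<in>UNIV. (2 * vD x - vG x) $ i * strain i k x) - sym_grad u x \<bullet> dE x $ k
    + div_u x * (vD x - vG x) $ k"
proof -
  have "sym_grad u x \<bullet> dE x $ k = (\<Sum>a\<in>UNIV. \<Sum>b\<in>UNIV. strain a b x * dstrain k a b x)"
    by (simp add: inner_vec_def dE_def sym_grad_eq_strain)
  then show ?thesis
    by (simp add: bracket_def lap_eq[OF assms] vD_def vG_def algebra_simps)
qed


lemma mat_dvg_A_map:
  assumes "\<And>i k. has_pderiv k (\<lambda>y. ext0 a (norm (sym_grad u y)) * strain i k y) (d i k) x"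
  shows "mat_dvg (\<lambda>y. A_map a (sym_grad u y)) x = (\<chi> i. \<Sum>k\<in>UNIV. d i k)"
  by (simp add: mat_dvg_def dvg_def A_map_nth sym_grad_eq_strain has_pderiv_imp_eq[OF assms])

lemma dvg_flux:
  assumes "x \<in> S"
    and d: "\<And>k. has_pderiv k (\<lambda>y. (ext0 a (norm (sym_grad u y)))\<^sup>2 * bracket k y) (d k) x"
  shows "dvg (flux a u) x = (\<Sum>k\<in>UNIV. d k)"
proof -
  have "has_pderiv k (\<lambda>y. flux a u y $ k) (d k) x" for k
    by (rule has_pderiv_transform_open[OF d open_S]) (simp_all add: assms(1) flux_eq_bracket)
  from has_pderiv_imp_eq[OF this] show ?thesis
    by (simp add: dvg_def)
qed

lemma div_u_eq_trace: "div_u y = (\<Sum>i\<in>UNIV. sym_grad u y $ i $ i)"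
  by (simp add: div_u_def sym_grad_eq_strain strain_def)

text \<open>The entries of E and all components of the bracket vanish at \<open>x\<close>, so only
  the terms that differentiate them survive, and continuity of the coefficient suffices.\<close>

lemma divergences_vanishing:
  assumes a: "C1_halfline (b_of a)" and x: "x \<in> S" and E: "sym_grad u x = 0"
  shows "mat_dvg (\<lambda>y. A_map a (sym_grad u y)) x = ext0 a 0 *\<^sub>R vD x"
    and "dvg (flux a u) x = (ext0 a 0)\<^sup>2 * (\<Sum>k\<in>UNIV. dbracket k x)"
proof -
  have strain0: "strain i j x = 0" for i j
    using E by (simp add: sym_grad_eq_strain[symmetric])
  have div0: "div_u x = 0"
    by (simp add: div_u_eq_trace E)
  have bracket0: "bracket k x = 0" for k
    by (simp add: bracket_def strain0 div0)
  have "sym_grad u differentiable (at x)"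
    using has_pderiv_sym_grad[OF x] by (simp add: has_pderiv_def)
  then have "isCont (\<lambda>y. norm (sym_grad u y)) x"
    by (intro continuous_intros differentiable_imp_continuous_within)
  \<comment> \<open>Continuity of \<open>ext0 a\<close> at 0 is available from the right only, and
    norms stay in that half-line.\<close>
  moreover have "continuous (at (norm (sym_grad u x)) within range (\<lambda>y. norm (sym_grad u y))) (ext0 a)"
    by (rule continuous_within_subset[of _ "{0..}"]) (use continuous_ext0_at_0[OF a] E in auto)
  ultimately have phi: "isCont (\<lambda>y. ext0 a (norm (sym_grad u y))) x"
    by (rule continuous_within_compose2[where g = "ext0 a"])
  then have phi2: "isCont (\<lambda>y. (ext0 a (norm (sym_grad u y)))\<^sup>2) x"
    by (intro continuous_intros)
  show "mat_dvg (\<lambda>y. A_map a (sym_grad u y)) x = ext0 a 0 *\<^sub>R vD x"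
    using mat_dvg_A_map[OF has_pderiv_mult_vanishing[OF has_pderiv_strain[OF x] strain0 phi]]
    by (simp add: E vD_def div_strain_def vec_eq_iff sum_distrib_left)
  show "dvg (flux a u) x = (ext0 a 0)\<^sup>2 * (\<Sum>k\<in>UNIV. dbracket k x)"
    using dvg_flux[OF x has_pderiv_mult_vanishing[OF has_pderiv_bracket[OF x] bracket0 phi2]]
    by (simp add: E sum_distrib_left)
qed

text \<open>Here the coefficient is differentiable and the product rule applies. The last two claims
  are the hypotheses on \<open>h\<close> and \<tau> of \<open>pointwise_inequality\<close>, with
  \<tau> the trace of E / t.\<close>

lemma divergences_nonvanishing:
  fixes a x
  defines "t \<equiv> norm (sym_grad u x)"
  defines "\<theta> \<equiv> t * deriv a t / a t"
    and "h \<equiv> (\<chi> k. (sym_grad u x \<bullet> dE x $ k) / t)"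
  defines "P \<equiv> (\<chi> i. \<Sum>k\<in>UNIV. strain i k x / t * h $ k)"
  assumes a: "C1_halfline (b_of a)" "a t > 0" and x: "x \<in> S" and E: "sym_grad u x \<noteq> 0"
  shows "mat_dvg (\<lambda>y. A_map a (sym_grad u y)) x = a t *\<^sub>R (vD x + \<theta> *\<^sub>R P)"
    and "dvg (flux a u) x = (a t)\<^sup>2 * ((\<Sum>k\<in>UNIV. dbracket k x)
      + 2 * \<theta> * (2 * (vD x \<bullet> P) - vG x \<bullet> P - (norm h)\<^sup>2 + div_u x / t * (h \<bullet> (vD x - vG x))))"
    and "(norm h)\<^sup>2 \<le> (norm (dE x))\<^sup>2"
    and "(div_u x / t)\<^sup>2 \<le> real CARD('n)"
proof -
  have t: "t > 0" using E by (simp add: t_def)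
  have ext0: "ext0 a t = a t" using t by (simp add: ext0_def)
  \<comment> \<open>This turns every derivative of the coefficient into a multiple of
    \<open>a t\<close> itself, so that \<open>a t\<close> factors out of both divergences.\<close>
  have dt: "deriv a t = a t * \<theta> / t" using t a(2) by (simp add: \<theta>_def)
  have "has_pderiv k (\<lambda>y. norm (sym_grad u y)) (h $ k) x" for k
    using has_pderiv_norm[OF has_pderiv_sym_grad[OF x, of k] E] by (simp add: h_def t_def dE_def)
  from has_pderiv_chain[OF _ this] DERIV_ext0[OF a(1) t]
  have phi: "has_pderiv k (\<lambda>y. ext0 a (norm (sym_grad u y))) (deriv a t * h $ k) x" for k
    by (simp add: t_def)
  have "mat_dvg (\<lambda>y. A_map a (sym_grad u y)) x
      = (\<chi> i. \<Sum>k\<in>UNIV. deriv a t * h $ k * strain i k x + a t * dstrain k i k x)"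
    using mat_dvg_A_map[OF has_pderiv_mult[OF phi has_pderiv_strain[OF x]]]
    by (simp add: t_def[symmetric] ext0)
  also have "\<dots> = a t *\<^sub>R (vD x + \<theta> *\<^sub>R P)"
    by (simp add: vec_eq_iff vD_def P_def div_strain_def dt sum.distrib sum_distrib_left distrib_left mult_ac)
  finally show "mat_dvg (\<lambda>y. A_map a (sym_grad u y)) x = a t *\<^sub>R (vD x + \<theta> *\<^sub>R P)" .
  \<comment> \<open>\<open>P\<close> is built from E / t, hence the factor \<open>t\<close>; it
    cancels against the one in \<open>dt\<close>.\<close>
  have P_inner: "(\<Sum>k\<in>UNIV. h $ k * (\<Sum>i\<in>UNIV. v $ i * strain i k x)) = t * (v \<bullet> P)" for v
  proof -
    have "t * (v \<bullet> P) = (\<Sum>i\<in>UNIV. \<Sum>k\<in>UNIV. h $ k * (v $ i * strain i k x))"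
      using t by (simp add: inner_vec_def P_def sum_distrib_left mult_ac)
    also have "\<dots> = (\<Sum>k\<in>UNIV. \<Sum>i\<in>UNIV. h $ k * (v $ i * strain i k x))"
      by (rule sum.swap)
    finally show ?thesis by (simp add: sum_distrib_left)
  qed
  have eX: "sym_grad u x \<bullet> dE x $ k = t * h $ k" for k
    using t by (simp add: h_def)
  have "(\<Sum>k\<in>UNIV. h $ k * bracket k x)
      = (\<Sum>k\<in>UNIV. h $ k * (\<Sum>i\<in>UNIV. (2 * vD x - vG x) $ i * strain i k x))
        - t * (\<Sum>k\<in>UNIV. h $ k * h $ k) + div_u x * (\<Sum>k\<in>UNIV. h $ k * (vD x - vG x) $ k)"
    unfolding bracket_eq[OF x] eX sum_distrib_left[of t] sum_distrib_left[of "div_u x"]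
      sum.distrib[symmetric] sum_subtractf[symmetric]
    by (intro sum.cong refl) (simp only: algebra_simps)
  also have "\<dots> = t * ((2 * vD x - vG x) \<bullet> P) - t * (h \<bullet> h) + div_u x * (h \<bullet> (vD x - vG x))"
    unfolding P_inner by (simp add: inner_vec_def)
  also have "(2 * vD x - vG x) \<bullet> P = 2 * (vD x \<bullet> P) - vG x \<bullet> P"
    by (simp add: inner_vec_def sum_subtractf sum_distrib_left algebra_simps)
  finally have hb: "(\<Sum>k\<in>UNIV. h $ k * bracket k x)
      = t * (2 * (vD x \<bullet> P) - vG x \<bullet> P - (norm h)\<^sup>2 + div_u x / t * (h \<bullet> (vD x - vG x)))"
    using t by (simp add: power2_norm_eq_inner right_diff_distrib distrib_left)
  have "dvg (flux a u) x = (\<Sum>k\<in>UNIV. 2 * a t * (deriv a t * h $ k) * bracket k x + (a t)\<^sup>2 * dbracket k x)"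
    using dvg_flux[OF x has_pderiv_mult[OF has_pderiv_power2[OF phi] has_pderiv_bracket[OF x]]]
    by (simp add: t_def[symmetric] ext0)
  also have "\<dots> = 2 * a t * deriv a t * (\<Sum>k\<in>UNIV. h $ k * bracket k x) + (a t)\<^sup>2 * (\<Sum>k\<in>UNIV. dbracket k x)"
    by (simp add: sum.distrib sum_distrib_left mult_ac)
  finally show "dvg (flux a u) x = (a t)\<^sup>2 * ((\<Sum>k\<in>UNIV. dbracket k x)
      + 2 * \<theta> * (2 * (vD x \<bullet> P) - vG x \<bullet> P - (norm h)\<^sup>2 + div_u x / t * (h \<bullet> (vD x - vG x))))"
    unfolding hb dt using t by (simp add: power2_eq_square distrib_left)
  \<comment> \<open>Each component of \<open>h\<close> is the inner product of a derivative of E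
    with the unit matrix E / t.\<close>
  have "\<bar>h $ k\<bar> \<le> norm (dE x $ k)" for k
    using Cauchy_Schwarz_ineq2[of "sym_grad u x" "dE x $ k"] t
    by (simp add: h_def t_def divide_le_eq mult.commute)
  then have "norm h \<le> norm (dE x)"
    unfolding norm_vec_def[of h] norm_vec_def[of "dE x"] by (intro L2_set_mono) auto
  then show "(norm h)\<^sup>2 \<le> (norm (dE x))\<^sup>2"
    by (simp add: power_mono)
  have "(div_u x)\<^sup>2 \<le> real CARD('n) * t\<^sup>2"
    using trace_squared_le[of "sym_grad u x"] by (simp add: t_def div_u_eq_trace)
  then show "(div_u x / t)\<^sup>2 \<le> real CARD('n)"
    using t by (simp add: power_divide divide_le_eq)
qed

section \<open>The pointwise estimate and the choice of the constants\<close>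

lemma differential_inequality:
  assumes a: "C1_halfline (b_of a)" "\<And>t. t > 0 \<Longrightarrow> a t > 0" and x: "x \<in> S"
    and delta: "0 \<le> \<delta>" "\<delta> \<le> 1 / 2" and m: "m \<le> 1"
    and theta: "\<And>t. t > 0 \<Longrightarrow> 2 * \<delta> * (1 + t * deriv a t / a t)\<^sup>2
        \<le> (1 + t * deriv a t / a t)\<^sup>2 - (real CARD('n) + 1) * (t * deriv a t / a t)\<^sup>2"
      "\<And>t. t > 0 \<Longrightarrow> m \<le> (1 + t * deriv a t / a t)\<^sup>2"
  shows "\<delta>\<^sup>2 * m * (ext0 a (norm (sym_grad u x)))\<^sup>2 * (norm (grad (sym_grad u) x))\<^sup>2
      + \<delta> * dvg (flux a u) x
    \<le> (1 + 2 * \<delta>) * (norm (mat_dvg (\<lambda>y. A_map a (sym_grad u y)) x))\<^sup>2"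
proof -
  define \<phi> where "\<phi> = ext0 a (norm (sym_grad u x))"
  obtain \<theta> \<tau> h P where *:
    "mat_dvg (\<lambda>y. A_map a (sym_grad u y)) x = \<phi> *\<^sub>R (vD x + \<theta> *\<^sub>R P)"
    "dvg (flux a u) x = \<phi>\<^sup>2 * (2 * (norm (vD x))\<^sup>2 - (norm (vG x))\<^sup>2 - (norm (dE x))\<^sup>2
      + 2 * \<theta> * (2 * (vD x \<bullet> P) - vG x \<bullet> P - (norm h)\<^sup>2 + \<tau> * (h \<bullet> (vD x - vG x))))"
    "(norm h)\<^sup>2 \<le> (norm (dE x))\<^sup>2" "\<tau>\<^sup>2 \<le> real CARD('n)"
    "2 * \<delta> * (1 + \<theta>)\<^sup>2 \<le> (1 + \<theta>)\<^sup>2 - (real CARD('n) + 1) * \<theta>\<^sup>2" "m \<le> (1 + \<theta>)\<^sup>2"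
  proof (cases "sym_grad u x = 0")
    case True
    \<comment> \<open>With \<theta> = 0 the two side conditions reduce to \<delta> \<le> 1/2 and m
      \<le> 1.\<close>
    show ?thesis
      by (rule that[of 0 0 0 0])
        (use divergences_vanishing[OF a(1) x True] delta m in
          \<open>simp_all add: sum_dbracket_norm[OF x] \<phi>_def True\<close>)
  next
    case False
    then have t: "norm (sym_grad u x) > 0" by simp
    then have phi: "a (norm (sym_grad u x)) = \<phi>"
      by (simp add: \<phi>_def ext0_def)
    note * = divergences_nonvanishing[OF a(1) a(2)[OF t] x False]
    show ?thesis
      by (rule that[OF *[unfolded phi sum_dbracket_norm[OF x]] theta[OF t, unfolded phi]])
  qed
  have grad: "grad (sym_grad u) x = dE x"
    using grad_sym_grad[OF x] by (simp add: dE_def)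
  have "\<delta>\<^sup>2 * m * \<phi>\<^sup>2 * (norm (dE x))\<^sup>2 + \<delta> * dvg (flux a u) x
    = \<phi>\<^sup>2 * (\<delta>\<^sup>2 * m * (norm (dE x))\<^sup>2 + \<delta> * (2 * (norm (vD x))\<^sup>2 - (norm (vG x))\<^sup>2 - (norm (dE x))\<^sup>2
      + 2 * \<theta> * (2 * (vD x \<bullet> P) - vG x \<bullet> P - (norm h)\<^sup>2 + \<tau> * (h \<bullet> (vD x - vG x)))))"
    unfolding *(2) distrib_left[of "\<phi>\<^sup>2" "\<delta>\<^sup>2 * m * (norm (dE x))\<^sup>2"] by (simp only: mult_ac)
  also have "\<dots> \<le> \<phi>\<^sup>2 * ((1 + 2 * \<delta>) * (norm (vD x + \<theta> *\<^sub>R P))\<^sup>2)"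
    using * delta m by (intro mult_left_mono pointwise_inequality[of _ _ _ "real CARD('n)"]) auto
  also have "\<dots> = (1 + 2 * \<delta>) * (norm (mat_dvg (\<lambda>y. A_map a (sym_grad u y)) x))\<^sup>2"
    unfolding *(1) by (simp add: power_mult_distrib)
  finally show ?thesis
    by (simp add: grad \<phi>_def)
qed

end

text \<open>The difference (1 + \<theta>)^2 - r^2 \<theta>^2 factors as (1 - (r - 1) \<theta>) (1 +
  (r + 1) \<theta>). The first factor decreases and the second increases in \<theta>, so taking them
  at \<open>s\<close> and at \<open>i\<close> respectively gives the uniform lower bound
  \<open>p\<close>; the strict bounds on the indices make both factors positive.\<close>

lemma index_window:
  fixes i s \<theta> r :: real
  assumes r: "1 < r" and i: "- 1 / (r + 1) < i" and s: "s < 1 / (r - 1)" and \<theta>: "i \<le> \<theta>" "\<theta> \<le> s"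
  defines "p \<equiv> (1 - (r - 1) * s) * (1 + (r + 1) * i)"
  shows "0 < 1 + i" "0 < 1 + s" "0 < p" "p \<le> (1 + \<theta>)\<^sup>2 - r\<^sup>2 * \<theta>\<^sup>2"
    "(1 + i)\<^sup>2 \<le> (1 + \<theta>)\<^sup>2" "(1 + \<theta>)\<^sup>2 \<le> (1 + s)\<^sup>2"
proof -
  have "- 1 < - 1 / (r + 1)" using r by (simp add: field_simps)
  with i show i1: "0 < 1 + i" by linarith
  with \<theta> show "0 < 1 + s" by linarith
  have fi: "0 < 1 + (r + 1) * i" using i r by (simp add: field_simps)
  have fs: "0 < 1 - (r - 1) * s" using s r by (simp add: field_simps)
  show "0 < p" unfolding p_def using fi fs by simp
  have "p \<le> (1 - (r - 1) * \<theta>) * (1 + (r + 1) * \<theta>)"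
    unfolding p_def
  proof (rule mult_mono)
    show 1: "1 - (r - 1) * s \<le> 1 - (r - 1) * \<theta>"
      using \<theta> r by (simp add: mult_left_mono)
    show "1 + (r + 1) * i \<le> 1 + (r + 1) * \<theta>"
      using \<theta> r by (simp add: mult_left_mono)
    show "0 \<le> 1 - (r - 1) * \<theta>" using 1 fs by linarith
    show "0 \<le> 1 + (r + 1) * i" using fi by simp
  qed
  also have "\<dots> = (1 + \<theta>)\<^sup>2 - r\<^sup>2 * \<theta>\<^sup>2"
    by (simp add: power2_eq_square algebra_simps)
  finally show "p \<le> (1 + \<theta>)\<^sup>2 - r\<^sup>2 * \<theta>\<^sup>2" .
  show "(1 + i)\<^sup>2 \<le> (1 + \<theta>)\<^sup>2" "(1 + \<theta>)\<^sup>2 \<le> (1 + s)\<^sup>2"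
    using i1 \<theta> by (auto intro!: power_mono)
qed

text \<open>Fixing \<open>i\<close> and \<open>s\<close> before the constants, and quantifying over
  \<open>a\<close> only afterwards, expresses that the constants depend on the indices and the
  dimension alone.\<close>

theorem lemma3p6:
  fixes i s :: ereal
  assumes "ereal (- 1 / (sqrt (real CARD('n::finite) + 1) + 1)) < i"
    and "i \<le> s"
    and "s < ereal (1 / (sqrt (real CARD('n) + 1) - 1))"
  shows "\<exists>c1 > (0::real). \<exists>c2 > (0::real).
    \<forall>(\<Omega> :: (real ^ 'n) set) (a :: real \<Rightarrow> real) (u :: real ^ 'n \<Rightarrow> real ^ 'n).
      open \<Omega> \<longrightarrow> (\<forall>t>0. a t > 0) \<longrightarrow> C1_halfline (b_of a) \<longrightarrow>
      idx_inf a = i \<longrightarrow> idx_sup a = s \<longrightarrow> Ck_on 3 u \<Omega> \<longrightarrow>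
      (\<forall>x\<in>\<Omega>.
        (norm (mat_dvg (\<lambda>y. A_map a (sym_grad u y)) x))\<^sup>2
          \<ge> c1 * (ext0 a (norm (sym_grad u x)))\<^sup>2 * (norm (grad (sym_grad u) x))\<^sup>2
            + c2 * dvg (flux a u) x)"
proof -
  define r where "r = sqrt (real CARD('n) + 1)"
  \<comment> \<open>The dimension is at least 1, so r - 1 is positive.\<close>
  have r: "1 < r" "r\<^sup>2 = real CARD('n) + 1" by (simp_all add: r_def)
  \<comment> \<open>The strict bounds exclude minus infinity for \<open>i\<close> and infinity for
    \<open>s\<close>; \<open>i \<le> s\<close> excludes the other infinite values.\<close>
  from assms obtain i' s' where eqs: "i = ereal i'" "s = ereal s'"
    by (cases i; cases s) auto
  have ir: "- 1 / (r + 1) < i'" and sr: "s' < 1 / (r - 1)" and le: "i' \<le> s'"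
    using assms by (simp_all add: eqs r_def)
  note window = index_window[OF r(1) ir sr]
  define p where "p = (1 - (r - 1) * s') * (1 + (r + 1) * i')"
  have pos: "0 < 1 + i'" "0 < 1 + s'" "0 < p"
    using window(1-3)[OF order_refl le] by (simp_all add: p_def)
  \<comment> \<open>The second entry makes \<open>2 * \<delta> * (1 + \<theta>)\<^sup>2\<close> at
    most \<open>p\<close> for all admissible \<theta>; the first is the bound needed where E
    vanishes and for 1 - 2 \<delta> to be nonnegative.\<close>
  define \<delta> where "\<delta> = min (1 / 2) (p / (2 * (1 + s')\<^sup>2))"
  define m where "m = min 1 ((1 + i')\<^sup>2)"
  have delta: "0 < \<delta>" "\<delta> \<le> 1 / 2" using pos by (simp_all add: \<delta>_def)
  have m: "0 < m" "m \<le> 1" using pos by (simp_all add: m_def)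
  have delta_theta: "2 * \<delta> * (1 + \<theta>)\<^sup>2 \<le> (1 + \<theta>)\<^sup>2 - (real CARD('n) + 1) * \<theta>\<^sup>2"
    and m_theta: "m \<le> (1 + \<theta>)\<^sup>2" if "i' \<le> \<theta>" "\<theta> \<le> s'" for \<theta>
  proof -
    have "2 * \<delta> * (1 + \<theta>)\<^sup>2 \<le> 2 * (p / (2 * (1 + s')\<^sup>2)) * (1 + s')\<^sup>2"
      using window(6)[OF that] delta by (intro mult_mono) (simp_all add: \<delta>_def)
    also have "\<dots> = p" using pos by simp
    also have "p \<le> (1 + \<theta>)\<^sup>2 - (real CARD('n) + 1) * \<theta>\<^sup>2"
      using window(4)[OF that] by (simp add: p_def r(2))
    finally show "2 * \<delta> * (1 + \<theta>)\<^sup>2 \<le> (1 + \<theta>)\<^sup>2 - (real CARD('n) + 1) * \<theta>\<^sup>2" .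
    show "m \<le> (1 + \<theta>)\<^sup>2"
      using window(5)[OF that] by (simp add: m_def)
  qed
  \<comment> \<open>Division of \<open>differential_inequality\<close> by the factor 1 + 2 \<delta>
    on its right-hand side gives these constants.\<close>
  let ?c1 = "\<delta>\<^sup>2 * m / (1 + 2 * \<delta>)" and ?c2 = "\<delta> / (1 + 2 * \<delta>)"
  have main: "?c1 * (ext0 a (norm (sym_grad u x)))\<^sup>2 * (norm (grad (sym_grad u) x))\<^sup>2
      + ?c2 * dvg (flux a u) x \<le> (norm (mat_dvg (\<lambda>y. A_map a (sym_grad u y)) x))\<^sup>2"
    if "open \<Omega>" "\<forall>t>0. a t > 0" "C1_halfline (b_of a)" "idx_inf a = i" "idx_sup a = s"
      "Ck_on 3 u \<Omega>" "x \<in> \<Omega>" for \<Omega> a and u :: "real ^ 'n \<Rightarrow> real ^ 'n" and x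
  proof -
    interpret C3_field \<Omega> u by unfold_locales fact+
    have bounds: "i' \<le> t * deriv a t / a t" "t * deriv a t / a t \<le> s'" if "t > 0" for t
    proof -
      have "idx_inf a \<le> ereal (t * deriv a t / a t)" "ereal (t * deriv a t / a t) \<le> idx_sup a"
        unfolding idx_inf_def idx_sup_def using that by (auto intro: INF_lower SUP_upper)
      then show "i' \<le> t * deriv a t / a t" "t * deriv a t / a t \<le> s'"
        using \<open>idx_inf a = i\<close> \<open>idx_sup a = s\<close> by (simp_all add: eqs)
    qed
    have "\<delta>\<^sup>2 * m * (ext0 a (norm (sym_grad u x)))\<^sup>2 * (norm (grad (sym_grad u) x))\<^sup>2
        + \<delta> * dvg (flux a u) x
      \<le> (1 + 2 * \<delta>) * (norm (mat_dvg (\<lambda>y. A_map a (sym_grad u y)) x))\<^sup>2"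
      using that delta m by (intro differential_inequality delta_theta m_theta bounds) auto
    then have "(\<delta>\<^sup>2 * m * (ext0 a (norm (sym_grad u x)))\<^sup>2 * (norm (grad (sym_grad u) x))\<^sup>2
        + \<delta> * dvg (flux a u) x) / (1 + 2 * \<delta>)
      \<le> (norm (mat_dvg (\<lambda>y. A_map a (sym_grad u y)) x))\<^sup>2"
      using delta by (subst pos_divide_le_eq) (simp, simp only: mult.commute[of _ "1 + 2 * \<delta>"])
    then show ?thesis
      by (simp add: add_divide_distrib)
  qed
  show ?thesis
  proof (rule exI[of _ ?c1], rule conjI[OF _ exI[of _ ?c2]], goal_cases)
    case 1
    show ?case using delta m by simp
  next
    case 2
    show ?case using delta main by (intro conjI allI impI ballI) simp_all
  qed
qed

end
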